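(* Let $n,k,\ell$ be integers with $k>\ell\geq 2$ and \[ n\geq \frac{(\ell+2)(\ell+1)^{\ell}-(\ell+1)\ell^{\ell}}{m_{\ell}(\ell+1)}\,k^2 . \] Then every intersecting family $\mathcal F\subset\binom{[n]}{k}$ satisfies \[ \gamma_\ell(\mathcal F)\leq m_{\ell}(\ell+1)\binom{n-2\ell-1}{k-\ell-1}+(\ell+1)\ell^{\ell}k\binom{n-2\ell-2}{k-\ell-2}. \]
   Context: A family $\mathcal F$ of sets is intersecting if $F\cap F'\neq\emptyset$ for all $F,F'\in\mathcal F$. For $S\subset[n]$, $\mathcal F(\overline S)=\{F\in\mathcal F: F\cap S=\emptyset\}$. The $\ell$-diversity is $\gamma_\ell(\mathcal F)=\min_{S\in\binom{[n]}{\ell}}|\mathcal F(\overline S)|$. The covering number $\tau(\mathcal F)$ is the minimum size of a set $T$ with $T\cap F\neq\emptyset$ for all $F\in\mathcal F$. For integers $0\le \ell<k$, $m_\ell(k)$ denotes the maximum of $\gamma_\ell(\mathcal F)$ over all $n$ and all intersecting families $\mathcal F\subset\binom{[n]}{k}$ with $\tau(\mathcal F)=k$. Binomial coefficients $\binom{a}{b}$ are $0$ when $b<0$ or $b>a$. *)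

theory Defs
  imports Complex_Main
begin

definition ksubsets :: "nat \<Rightarrow> nat \<Rightarrow> nat set set" where
  "ksubsets n k = {A. A \<subseteq> {1..n} \<and> card A = k}"

definition intersecting :: "'a set set \<Rightarrow> bool" where
  "intersecting F \<longleftrightarrow> (\<forall>A\<in>F. \<forall>B\<in>F. A \<inter> B \<noteq> {})"

definition avoid :: "'a set set \<Rightarrow> 'a set \<Rightarrow> 'a set set" where
  "avoid F S = {A \<in> F. A \<inter> S = {}}"

definition diversity :: "nat \<Rightarrow> nat \<Rightarrow> nat set set \<Rightarrow> nat" where
  "diversity n l F = Min {card (avoid F S) | S. S \<subseteq> {1..n} \<and> card S = l}"

definition cover_number :: "'a set set \<Rightarrow> nat" where
  "cover_number F = Inf {card T | T. finite T \<and> (\<forall>A\<in>F. T \<inter> A \<noteq> {})}"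

definition m_div :: "nat \<Rightarrow> nat \<Rightarrow> nat" where
  "m_div l k = Sup {diversity n l F | n F. F \<subseteq> ksubsets n k \<and> intersecting F \<and> cover_number F = k}"

definition binom :: "int \<Rightarrow> int \<Rightarrow> nat" where
  "binom a b = (if b < 0 \<or> b > a then 0 else nat a choose nat b)"

end

theory Submission
  imports Defs
begin

text \<open>Enlarge \<open>F\<close> to a maximal intersecting family, so that any two transversals of size at most \<open>k\<close>
  meet, and let \<open>t\<close> be least such that no \<open>l\<close>-set covers all transversals of size at most \<open>t\<close>.
  Choose an \<open>l\<close>-set \<open>S\<close> covering all smaller transversals and missing as few transversals of size
  \<open>t\<close> as possible. A member of the family disjoint from \<open>S\<close> meets every transversal, so it can be
  reached by branching \<open>l + 1\<close> times over transversals of size at most \<open>t\<close>, after which one branches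
  over members of the family; this gives at most \<open>t (t - 1)\<^sup>l k\<^bsup>t - l - 1\<^esup>\<close> sets of size \<open>t\<close>.
  For \<open>t \<ge> l + 2\<close> the resulting bound is decreasing in \<open>t\<close> and, by the hypothesis on \<open>n\<close>, at \<open>t = l + 2\<close>
  it is at most the right-hand side. For \<open>t = l + 1\<close> the transversals of size \<open>l + 1\<close> form an
  intersecting family with covering number \<open>l + 1\<close>, of which \<open>S\<close> misses at most \<open>m\<^sub>l(l + 1)\<close>; members
  containing none of the missed ones are counted by branching once more. The estimates for the
  hypothesis on \<open>n\<close> need only \<open>1 \<le> m\<^sub>l(l + 1) \<le> (l + 1)\<^sup>l\<close>.\<close>

section \<open>Counting by branching over sets that must be met\<close>

definition covers :: "'a set set \<Rightarrow> 'a set \<Rightarrow> bool" where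
  "covers F T \<longleftrightarrow> (\<forall>A\<in>F. T \<inter> A \<noteq> {})"

lemma covers_mono: "covers F S \<Longrightarrow> S \<subseteq> T \<Longrightarrow> covers F T"
  unfolding covers_def by blast

lemma branch_step:
  assumes "finite \<G>" "finite D"
    and meet: "\<And>A. A \<in> \<G> \<Longrightarrow> X \<subseteq> A \<Longrightarrow> A \<inter> D \<noteq> {}"
    and w: "\<And>x. x \<in> D \<Longrightarrow> card {A\<in>\<G>. insert x X \<subseteq> A} \<le> w"
  shows "card {A\<in>\<G>. X \<subseteq> A} \<le> card D * w"
proof -
  have "{A\<in>\<G>. X \<subseteq> A} \<subseteq> (\<Union>x\<in>D. {A\<in>\<G>. insert x X \<subseteq> A})"
    using meet by fastforce
  moreover have "finite (\<Union>x\<in>D. {A\<in>\<G>. insert x X \<subseteq> A})" using assms(1,2) by simp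
  ultimately have "card {A\<in>\<G>. X \<subseteq> A} \<le> card (\<Union>x\<in>D. {A\<in>\<G>. insert x X \<subseteq> A})"
    by (intro card_mono)
  also have "\<dots> \<le> (\<Sum>x\<in>D. card {A\<in>\<G>. insert x X \<subseteq> A})"
    by (rule card_UN_le) fact
  also have "\<dots> \<le> card D * w"
    using sum_bounded_above[of D "\<lambda>x. card {A\<in>\<G>. insert x X \<subseteq> A}" w] w by simp
  finally show ?thesis .
qed

text \<open>\<open>P\<close> is an invariant of the partial sets. Points of \<open>D\<close> lie
  outside \<open>X\<close>, so each branching raises the size by exactly one and costs a factor
  \<open>d\<close>; sets of size \<open>r\<close> are the leaves, of weight
  \<open>w\<close>.\<close>

lemma branch_iterate:
  assumes fin: "finite \<G>"
    and finX: "\<And>X. P X \<Longrightarrow> finite X"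
    and step: "\<And>X. P X \<Longrightarrow> card X < r \<Longrightarrow> \<exists>D. finite D \<and> card D \<le> d \<and>
        (\<forall>A\<in>\<G>. X \<subseteq> A \<longrightarrow> A \<inter> D \<noteq> {}) \<and> (\<forall>x\<in>D. x \<notin> X \<and> P (insert x X))"
    and leaf: "\<And>X. P X \<Longrightarrow> card X = r \<Longrightarrow> card {A\<in>\<G>. X \<subseteq> A} \<le> w"
  shows "P X \<Longrightarrow> card X + j = r \<Longrightarrow> card {A\<in>\<G>. X \<subseteq> A} \<le> d ^ j * w"
proof (induction j arbitrary: X)
  case 0
  then show ?case using leaf by simp
next
  case (Suc j)
  obtain D where D: "finite D" "card D \<le> d" "\<forall>A\<in>\<G>. X \<subseteq> A \<longrightarrow> A \<inter> D \<noteq> {}"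
      "\<forall>x\<in>D. x \<notin> X \<and> P (insert x X)"
    using step[OF Suc.prems(1)] Suc.prems(2) by auto
  have "card {A\<in>\<G>. insert x X \<subseteq> A} \<le> d ^ j * w" if "x \<in> D" for x
    using that D(4) Suc.prems(2) finX[OF Suc.prems(1)] by (intro Suc.IH) auto
  then have "card {A\<in>\<G>. X \<subseteq> A} \<le> card D * (d ^ j * w)"
    using D by (intro branch_step[OF fin]) auto
  also have "\<dots> \<le> d * (d ^ j * w)"
    using D(2) by (rule mult_le_mono1)
  finally show ?case by (simp add: mult.assoc)
qed

text \<open>Once a branch set disjoint from \<open>S\<close> has been used (which happens only if no branch set
  meeting \<open>S\<close> or smaller than \<open>t\<close> is available), minimality of \<open>S\<close> guarantees that branch sets with
  at most \<open>t - 1\<close> elements outside \<open>S\<close> exist ever after. Hence only one factor is \<open>t\<close>.\<close>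

lemma card_branching_le:
  fixes C \<G> :: "'a set set"
  assumes V: "finite V" "C \<subseteq> Pow V" and t: "\<And>T. T \<in> C \<Longrightarrow> card T \<le> t"
    and nocover: "\<And>X. X \<subseteq> V \<Longrightarrow> card X \<le> l \<Longrightarrow> \<not> covers C X"
    and S: "S \<subseteq> V"
    and min: "\<And>X. X \<subseteq> V \<Longrightarrow> card X \<le> l \<Longrightarrow> covers {T\<in>C. card T < t} X \<Longrightarrow>
                card (avoid C S) \<le> card (avoid C X)"
    and \<G>: "finite \<G>" "\<And>A. A \<in> \<G> \<Longrightarrow> A \<inter> S = {}" "\<And>A. A \<in> \<G> \<Longrightarrow> covers C A"
    and w: "\<And>X. X \<subseteq> V \<Longrightarrow> X \<inter> S = {} \<Longrightarrow> card X = Suc l \<Longrightarrow> card {A\<in>\<G>. X \<subseteq> A} \<le> w"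
  shows "card \<G> \<le> t * (t - 1) ^ l * w"
proof -
  have finC: "finite C" using V by (meson finite_Pow_iff finite_subset)
  have finT: "finite T" if "T \<in> C" for T using that V by (meson PowD finite_subset subsetD)
  have meets: "A \<inter> (B - S) \<noteq> {}" if "A \<in> \<G>" "B \<in> C" for A B
    using \<G>(2,3)[OF that(1)] that(2) unfolding covers_def by blast
  define base where "base = (\<lambda>X. X \<subseteq> V \<and> X \<inter> S = {})"
  define small where "small = (\<lambda>X. \<exists>B\<in>C. X \<inter> B = {} \<and> card (B - S) \<le> t - 1)"
  have base_insert: "x \<notin> X \<and> base (insert x X)"
    if "base X" "B \<in> C" "X \<inter> B = {}" "x \<in> B - S" for x X B
  proof -
    have "x \<in> V" "x \<notin> S" "x \<notin> X" using that(2-4) V(2) by auto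
    then show ?thesis using that(1) unfolding base_def by simp
  qed
  \<comment> \<open>Without a cheap branching, every set missed by \<open>X\<close> is disjoint from
    \<open>S\<close> and has size exactly \<open>t\<close>. So \<open>X\<close> covers the smaller
    sets and misses only what \<open>S\<close> misses; minimality of \<open>S\<close> forces
    equality.\<close>
  have same: "avoid C X = avoid C S \<and> (\<forall>B\<in>avoid C S. card B = t)"
    if X: "base X" "card X \<le> l" "\<not> small X" for X
  proof -
    have *: "B \<inter> S = {} \<and> card B = t" if "B \<in> C" "X \<inter> B = {}" for B
    proof -
      have lt: "\<not> card (B - S) \<le> t - 1" using X(3) that unfolding small_def by blast
      have le: "card (B - S) \<le> card B" using finT[OF that(1)] by (intro card_mono) auto
      have eq: "card (B - S) = card B" "card B = t" using lt le t[OF that(1)] by linarith+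
      have "B - S = B" using finT[OF that(1)] eq by (intro card_subset_eq) auto
      then show ?thesis using eq by blast
    qed
    have sub: "avoid C X \<subseteq> avoid C S" using * by (auto simp: avoid_def Int_commute)
    have "X \<inter> B \<noteq> {}" if "B \<in> C" "card B < t" for B using *[of B] that by auto
    then have "covers {T\<in>C. card T < t} X" by (simp add: covers_def)
    then have "card (avoid C S) \<le> card (avoid C X)" by (intro min) (use X(1,2) base_def in simp_all)
    then have "avoid C X = avoid C S"
      using sub finC by (intro card_seteq) (auto simp: avoid_def)
    moreover have "card B = t" if "B \<in> avoid C X" for B
      using *[of B] that by (simp add: avoid_def Int_commute)
    ultimately show ?thesis by simp
  qed
  \<comment> \<open>A flagged \<open>X\<close> meets a set that \<open>S\<close> misses, so the
    conclusion of \<open>same\<close> fails and a cheap branching exists. Flags survive insertion,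
    so all later factors are \<open>t - 1\<close>.\<close>
  define flag where "flag = (\<lambda>X. base X \<and> (\<exists>B\<in>avoid C S. B \<inter> X \<noteq> {}))"
  have flagged: "card {A\<in>\<G>. X \<subseteq> A} \<le> (t - 1) ^ j * w" if "flag X" "card X + j = Suc l" for X j
  proof (rule branch_iterate[where P = flag and r = "Suc l"])
    show "flag X" "card X + j = Suc l" "finite \<G>" by fact+
    show "finite X" if "flag X" for X
      using that V(1) unfolding flag_def base_def by (blast intro: finite_subset)
    show "card {A\<in>\<G>. X \<subseteq> A} \<le> w" if "flag X" "card X = Suc l" for X
      using that w unfolding flag_def base_def by blast
    fix X assume X: "flag X" "card X < Suc l"
    have "small X"
    proof (rule ccontr)
      assume "\<not> small X"
      then have "avoid C X = avoid C S" using same[of X] X unfolding flag_def by simp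
      moreover obtain B where "B \<in> avoid C S" "B \<inter> X \<noteq> {}" using X(1) unfolding flag_def by blast
      ultimately show False by (auto simp: avoid_def)
    qed
    then obtain B where B: "B \<in> C" "X \<inter> B = {}" "card (B - S) \<le> t - 1"
      unfolding small_def by blast
    have "x \<notin> X \<and> flag (insert x X)" if "x \<in> B - S" for x
    proof -
      have "base X" "\<exists>B\<in>avoid C S. B \<inter> insert x X \<noteq> {}" using X(1) unfolding flag_def by auto
      then show ?thesis using base_insert[OF _ B(1,2) that] unfolding flag_def by simp
    qed
    then show "\<exists>D. finite D \<and> card D \<le> t - 1 \<and> (\<forall>A\<in>\<G>. X \<subseteq> A \<longrightarrow> A \<inter> D \<noteq> {}) \<and>
        (\<forall>x\<in>D. x \<notin> X \<and> flag (insert x X))"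
      using B(3) meets[OF _ B(1)] finT[OF B(1)] by (intro exI[of _ "B - S"]) simp
  qed
  \<comment> \<open>There remain \<open>l + 1 - card X = j + 1\<close> branchings: one is charged
    \<open>t\<close>, the other \<open>j\<close> are charged \<open>t - 1\<close>.\<close>
  have "card {A\<in>\<G>. X \<subseteq> A} \<le> t * (t - 1) ^ j * w" if "base X" "card X + j = l" for X j
    using that
  proof (induction j arbitrary: X)
    case 0
    obtain B where B: "B \<in> C" "X \<inter> B = {}"
      using nocover[of X] 0 unfolding base_def covers_def by auto
    have finX: "finite X" using 0 V(1) unfolding base_def by (blast intro: finite_subset)
    have "card {A\<in>\<G>. X \<subseteq> A} \<le> card (B - S) * w"
    proof (rule branch_step[OF \<G>(1)])
      show "finite (B - S)" using finT[OF B(1)] by simp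
      show "A \<inter> (B - S) \<noteq> {}" if "A \<in> \<G>" for A using meets[OF that B(1)] .
      show "card {A\<in>\<G>. insert x X \<subseteq> A} \<le> w" if "x \<in> B - S" for x
        using base_insert[OF 0(1) B that] finX 0(2) unfolding base_def by (intro w) auto
    qed
    also have "\<dots> \<le> t * w"
      using card_mono[OF finT[OF B(1)], of "B - S"] t[OF B(1)] by (intro mult_le_mono1) auto
    finally show ?case by simp
  next
    case (Suc j)
    have finX: "finite X" using Suc V(1) unfolding base_def by (blast intro: finite_subset)
    show ?case
    proof (cases "small X")
      case True
      then obtain B where B: "B \<in> C" "X \<inter> B = {}" "card (B - S) \<le> t - 1"
        unfolding small_def by blast
      have "card {A\<in>\<G>. X \<subseteq> A} \<le> card (B - S) * (t * (t - 1) ^ j * w)"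
      proof (rule branch_step[OF \<G>(1)])
        show "finite (B - S)" using finT[OF B(1)] by simp
        show "A \<inter> (B - S) \<noteq> {}" if "A \<in> \<G>" for A using meets[OF that B(1)] .
        show "card {A\<in>\<G>. insert x X \<subseteq> A} \<le> t * (t - 1) ^ j * w" if "x \<in> B - S" for x
          using base_insert[OF Suc.prems(1) B(1,2) that] finX Suc.prems(2) by (intro Suc.IH) auto
      qed
      also have "\<dots> \<le> (t - 1) * (t * (t - 1) ^ j * w)" using B(3) by (rule mult_le_mono1)
      finally show ?thesis by (simp add: mult_ac)
    next
      case False
      obtain B where B: "B \<in> C" "X \<inter> B = {}"
        using nocover[of X] Suc.prems unfolding base_def covers_def by auto
      \<comment> \<open>The expensive branching is paid for here: \<open>B\<close> misses
        \<open>S\<close>, so each of its points flags the enlarged set.\<close>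
      have BS: "B \<in> avoid C S"
        using same[OF Suc.prems(1) _ False] Suc.prems(2) B unfolding avoid_def by auto
      have "card {A\<in>\<G>. X \<subseteq> A} \<le> card (B - S) * ((t - 1) ^ Suc j * w)"
      proof (rule branch_step[OF \<G>(1)])
        show "finite (B - S)" using finT[OF B(1)] by simp
        show "A \<inter> (B - S) \<noteq> {}" if "A \<in> \<G>" for A using meets[OF that B(1)] .
        show "card {A\<in>\<G>. insert x X \<subseteq> A} \<le> (t - 1) ^ Suc j * w" if "x \<in> B - S" for x
        proof (rule flagged)
          show "flag (insert x X)"
            using base_insert[OF Suc.prems(1) B that] BS that unfolding flag_def
            by (intro conjI bexI[of _ B]) auto
          show "card (insert x X) + Suc j = Suc l"
            using base_insert[OF Suc.prems(1) B that] finX Suc.prems(2) by auto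
        qed
      qed
      also have "\<dots> \<le> t * ((t - 1) ^ Suc j * w)"
        using card_mono[OF finT[OF B(1)], of "B - S"] t[OF B(1)] by (intro mult_le_mono1) auto
      finally show ?thesis by (simp add: mult_ac)
    qed
  qed
  from this[of "{}" l] show ?thesis unfolding base_def by simp
qed

section \<open>Diversity and covering number\<close>

lemma finite_ksubsets: "finite (ksubsets n k)"
  unfolding ksubsets_def by (rule finite_subset[of _ "Pow {1..n}"]) auto

lemma finite_avoid: "finite F \<Longrightarrow> finite (avoid F S)"
  unfolding avoid_def by simp

lemma finite_diversity_set:
  fixes n :: nat
  shows "finite {card (avoid F S) | S. S \<subseteq> {1..n} \<and> card S = l}"
  using finite_ksubsets[of n l] by (auto simp: ksubsets_def)

lemma diversity_le: "S \<subseteq> {1..n} \<Longrightarrow> card S = l \<Longrightarrow> diversity n l F \<le> card (avoid F S)"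
  unfolding diversity_def by (rule Min_le[OF finite_diversity_set]) blast

lemma diversity_attained:
  assumes "l \<le> n"
  obtains S where "S \<subseteq> {1..n}" "card S = l" "diversity n l F = card (avoid F S)"
proof -
  have "{card (avoid F S) | S. S \<subseteq> {1..n} \<and> card S = l} \<noteq> {}"
    using obtain_subset_with_card_n[of l "{1..n}"] assms by auto
  from Min_in[OF finite_diversity_set this] show ?thesis
    using that unfolding diversity_def by blast
qed

lemma diversity_mono:
  assumes "l \<le> n" "F \<subseteq> G" "finite G"
  shows "diversity n l F \<le> diversity n l G"
proof -
  obtain S where S: "S \<subseteq> {1..n}" "card S = l" "diversity n l G = card (avoid G S)"
    using diversity_attained assms(1) by metis
  have "card (avoid F S) \<le> card (avoid G S)"
    using assms(2,3) by (intro card_mono finite_avoid) (auto simp: avoid_def)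
  then show ?thesis using diversity_le[OF S(1,2), of F] S(3) by simp
qed

lemma extend_subset:
  assumes "finite V" "X \<subseteq> V" "card X \<le> l" "l \<le> card V"
  obtains Y where "X \<subseteq> Y" "Y \<subseteq> V" "card Y = l"
  using exists_subset_between[of X l V] assms by blast

lemma cover_number_le: "finite T \<Longrightarrow> covers F T \<Longrightarrow> cover_number F \<le> card T"
  unfolding cover_number_def covers_def by (rule cInf_lower) auto

lemma cover_number_ge:
  assumes "finite T" "covers F T" "\<And>T. finite T \<Longrightarrow> covers F T \<Longrightarrow> r \<le> card T"
  shows "r \<le> cover_number F"
  unfolding cover_number_def using assms by (intro cInf_greatest) (auto simp: covers_def)

section \<open>Bounds on \<open>m_div l (l + 1)\<close>\<close>

text \<open>Remove a point \<open>y\<close> from a member \<open>G\<close>: members avoiding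
  \<open>G - {y}\<close> still meet \<open>G\<close>, hence contain \<open>y\<close>. As no
  \<open>l\<close>-set is a cover, \<open>l\<close> branchings over missed members, with
  \<open>l + 1\<close> choices each, determine such a member. This also bounds the set whose
  supremum is \<open>m_div\<close>.\<close>

lemma diversity_le_power:
  assumes F: "F \<subseteq> ksubsets n (l + 1)" "intersecting F" "cover_number F = l + 1"
  shows "diversity n l F \<le> (l + 1) ^ l"
proof -
  have finF: "finite F" using F(1) finite_ksubsets finite_subset by blast
  have FD: "A \<subseteq> {1..n}" "finite A" "card A = l + 1" if "A \<in> F" for A
    using F(1) that by (auto simp: ksubsets_def intro: finite_subset)
  have nocover: "\<not> covers F X" if "finite X" "card X \<le> l" for X
    using cover_number_le[of X F] that F(3) by auto
  obtain G where G: "G \<in> F" using nocover[of "{}"] by (auto simp: covers_def)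
  obtain y where y: "y \<in> G" using FD[OF G] by fastforce
  have "card {A\<in>F. {y} \<subseteq> A} \<le> (l + 1) ^ l * 1"
  proof (rule branch_iterate[where P = finite and r = "l + 1" and \<G> = F])
    show "finite F" by fact
    show "card {A\<in>F. X \<subseteq> A} \<le> 1" if "finite X" "card X = l + 1" for X
    proof -
      have "A = X" if "A \<in> F" "X \<subseteq> A" for A
        using card_subset_eq[of A X] FD[OF that(1)] that(2) \<open>card X = l + 1\<close> by simp
      then have "{A\<in>F. X \<subseteq> A} \<subseteq> {X}" by blast
      then show ?thesis using card_mono[of "{X}"] by auto
    qed
    fix X :: "nat set" assume X: "finite X" "card X < l + 1"
    then obtain B where "B \<in> F" "X \<inter> B = {}" using nocover[of X] unfolding covers_def by auto
    then show "\<exists>D. finite D \<and> card D \<le> l + 1 \<and> (\<forall>A\<in>F. X \<subseteq> A \<longrightarrow> A \<inter> D \<noteq> {}) \<and>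
        (\<forall>x\<in>D. x \<notin> X \<and> finite (insert x X))"
      using FD F(2) X unfolding intersecting_def by (intro exI[of _ B]) auto
  qed auto
  moreover have "avoid F (G - {y}) \<subseteq> {A\<in>F. {y} \<subseteq> A}"
    using F(2) G unfolding avoid_def intersecting_def by blast
  then have "card (avoid F (G - {y})) \<le> card {A\<in>F. {y} \<subseteq> A}"
    using finF by (intro card_mono) auto
  moreover have "diversity n l F \<le> card (avoid F (G - {y}))"
    using FD[OF G] y by (intro diversity_le) auto
  ultimately show ?thesis by simp
qed

abbreviation "m_div_set l \<equiv>
  {diversity n l F | n F. F \<subseteq> ksubsets n (l + 1) \<and> intersecting F \<and> cover_number F = l + 1}"

lemma m_div_set_le:
  assumes "x \<in> m_div_set l"
  shows "x \<le> (l + 1) ^ l"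
proof -
  obtain n F where "x = diversity n l F" "F \<subseteq> ksubsets n (l + 1)" "intersecting F"
      "cover_number F = l + 1"
    using assms unfolding mem_Collect_eq by (elim exE conjE)
  then show ?thesis using diversity_le_power by simp
qed

lemma bdd_m_div_set: "bdd_above (m_div_set l)"
  by (rule bdd_aboveI) (rule m_div_set_le)

lemma diversity_le_m_div:
  "F \<subseteq> ksubsets n (l + 1) \<Longrightarrow> intersecting F \<Longrightarrow> cover_number F = l + 1 \<Longrightarrow>
    diversity n l F \<le> m_div l (l + 1)"
  unfolding m_div_def by (rule cSup_upper[OF _ bdd_m_div_set]) blast

text \<open>Two \<open>(l + 1)\<close>-sets cannot be disjoint among \<open>2 * l + 1\<close>
  points, while any \<open>l\<close> points leave room for an \<open>(l + 1)\<close>-set. This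
  family shows that \<open>m_div l (l + 1)\<close> is positive and that the set defining it is
  nonempty.\<close>

lemma complete_family:
  fixes l defines "F \<equiv> ksubsets (2 * l + 1) (l + 1)"
  shows "intersecting F" "cover_number F = l + 1" "1 \<le> diversity (2 * l + 1) l F"
proof -
  let ?V = "{1..2 * l + 1}"
  have ex: "\<exists>A\<in>F. A \<inter> T = {}" if "finite T" "card T \<le> l" for T
  proof -
    have "card (?V - T) \<ge> l + 1" using diff_card_le_card_Diff[OF that(1), of ?V] that(2) by auto
    then obtain A where "A \<subseteq> ?V - T" "card A = l + 1" by (metis obtain_subset_with_card_n)
    then show ?thesis unfolding F_def ksubsets_def by blast
  qed
  have meet: "A \<inter> B \<noteq> {}" if A: "A \<subseteq> ?V" "l + 1 \<le> card A" and B: "B \<in> F" for A B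
  proof
    assume "A \<inter> B = {}"
    moreover have "A \<union> B \<subseteq> ?V" "finite A" "finite B" using A B finite_subset[of _ ?V]
      by (auto simp: F_def ksubsets_def)
    ultimately have "card A + card B \<le> card ?V"
      by (metis card_Un_disjoint card_mono finite_atLeastAtMost)
    then show False using A B by (auto simp: F_def ksubsets_def)
  qed
  show "intersecting F" unfolding intersecting_def
    using meet by (auto simp: F_def ksubsets_def)
  have "covers F {1..l + 1}" using meet[of "{1..l + 1}"] by (auto simp: covers_def)
  moreover have "l + 1 \<le> card T" if "finite T" "covers F T" for T
    using ex[OF that(1)] that(2) unfolding covers_def by (metis Int_commute not_less_eq_eq Suc_eq_plus1)
  ultimately show "cover_number F = l + 1"
    using cover_number_le[of "{1..l + 1}" F] cover_number_ge[of "{1..l + 1}" F "l + 1"]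
    by (intro antisym) auto
  obtain S where S: "S \<subseteq> ?V" "card S = l" "diversity (2 * l + 1) l F = card (avoid F S)"
    using diversity_attained[of l "2 * l + 1" F] by auto
  have "avoid F S \<noteq> {}" using ex[of S] S finite_subset[OF S(1)] by (auto simp: avoid_def)
  then have "card (avoid F S) > 0"
    using finite_avoid[of F S] finite_ksubsets F_def by (simp add: card_gt_0_iff)
  then show "1 \<le> diversity (2 * l + 1) l F" using S(3) by simp
qed

lemma m_div_pos: "1 \<le> m_div l (l + 1)"
  by (rule order_trans[OF complete_family(3) diversity_le_m_div[OF subset_refl complete_family(1,2)]])

lemma m_div_le: "m_div l (l + 1) \<le> (l + 1) ^ l"
  unfolding m_div_def
proof (rule cSup_least)
  have "diversity (2 * l + 1) l (ksubsets (2 * l + 1) (l + 1)) \<in> m_div_set l"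
    unfolding mem_Collect_eq
    by (intro exI[of _ "2 * l + 1"] exI[of _ "ksubsets (2 * l + 1) (l + 1)"]
          conjI refl subset_refl complete_family)
  then show "m_div_set l \<noteq> {}" by blast
qed (rule m_div_set_le)

section \<open>Numerical estimates for the branching bound\<close>

text \<open>Bernoulli's inequality \<open>(1 - 1/t)^j >= 1 - j/t\<close> with denominators cleared;
  for \<open>j >= t\<close> truncated subtraction makes the left side zero.\<close>

lemma power_mult_diff_le:
  fixes t :: nat
  shows "t ^ j * (t - j) \<le> t * (t - 1) ^ j"
proof (induction j)
  case (Suc j)
  have "t * (t - Suc j) \<le> (t - 1) * (t - j)"
  proof (cases "Suc j \<le> t")
    case True
    then obtain s where "t = Suc j + s" using le_Suc_ex by blast
    then show ?thesis by (simp add: algebra_simps)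
  qed simp
  then have "t ^ Suc j * (t - Suc j) \<le> t ^ j * ((t - 1) * (t - j))"
    by (simp add: mult.left_commute)
  also have "\<dots> = (t - 1) * (t ^ j * (t - j))" by simp
  also have "\<dots> \<le> (t - 1) * (t * (t - 1) ^ j)" using Suc.IH by (rule mult_le_mono2)
  finally show ?case by (simp add: mult.left_commute)
qed simp

text \<open>Bernoulli's inequality \<open>(1 + 1/a)^j >= 1 + j/a\<close> with denominators
  cleared.\<close>

lemma power_mult_add_le:
  fixes a :: nat
  shows "a ^ j * (a + j) \<le> (a + 1) ^ j * a"
proof (induction j)
  case (Suc j)
  have "a * (a + Suc j) \<le> (a + 1) * (a + j)" by (simp add: algebra_simps)
  then have "a ^ j * (a * (a + Suc j)) \<le> a ^ j * ((a + 1) * (a + j))" by (rule mult_le_mono2)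
  then have "a ^ Suc j * (a + Suc j) \<le> a ^ j * ((a + 1) * (a + j))" by (simp only: power_Suc mult_ac)
  also have "\<dots> = (a + 1) * (a ^ j * (a + j))" by (simp add: algebra_simps)
  also have "\<dots> \<le> (a + 1) * ((a + 1) ^ j * a)" using Suc.IH by (rule mult_le_mono2)
  finally show ?case by (simp only: power_Suc mult.assoc)
qed simp

lemma two_power_le:
  fixes l :: nat
  assumes "0 < l"
  shows "2 * l ^ l \<le> (l + 1) ^ l"
  using power_mult_add_le[of l l] assms by (simp add: algebra_simps flip: mult_2)

lemma choose_absorb:
  assumes "b < k" "k \<le> a"
  shows "(k - b) * ((a - b) choose (k - b)) = (a - b) * ((a - Suc b) choose (k - Suc b))"
  using assms times_binomial_minus1_eq[of "k - b" "a - b"] by simp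

text \<open>Consecutive values of \<open>t\<close> are compared by their ratio: absorption turns the
  binomials into \<open>(k - t) / (n - l - t)\<close>, and \<open>power_mult_diff_le\<close> handles
  the powers of \<open>t\<close> and \<open>t - 1\<close>. What remains is the inequality
  \<open>key\<close>.\<close>

lemma branch_bound_decreasing:
  assumes n: "(l + 3) * k ^ 2 \<le> 2 * n" and t: "l + 2 \<le> t" "t \<le> k"
  shows "t * (t - 1) ^ l * (k ^ (t - l - 1) * ((n - l - t) choose (k - t)))
           \<le> (l + 2) * (l + 1) ^ l * (k * ((n - 2 * l - 2) choose (k - l - 2)))"
  using t
proof (induction t rule: dec_induct)
  case base
  have "n - l - (l + 2) = n - 2 * l - 2" by simp
  then show ?case by (simp add: mult.assoc)
next
  case (step t)
  have kt: "t < k" "t - l \<ge> 2" using step by auto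
  obtain s where s: "t = l + 2 + s" using step le_Suc_ex by blast
  \<comment> \<open>The ratio \<open>(t + 1) / (t - l)\<close> is largest at
    \<open>t = l + 2\<close>, where it equals \<open>(l + 3) / 2\<close>; this is the constant in
    the assumption on \<open>n\<close>.\<close>
  have "(t + 1) * 2 \<le> (l + 3) * (t - l)" using s by (simp add: algebra_simps)
  then have "(t + 1) * 2 * (k * (k - t)) \<le> (l + 3) * (t - l) * (k * (k - t))"
    by (rule mult_le_mono1)
  also have "\<dots> = (t - l) * ((l + 3) * (k * (k - t)))" by (simp only: mult_ac)
  also have "\<dots> \<le> (t - l) * (2 * (n - l - t))"
  proof (rule mult_le_mono2)
    obtain u where u: "k = t + u" using kt le_Suc_ex less_imp_le by blast
    \<comment> \<open>The part \<open>(l + 3) * k * t\<close> of \<open>(l + 3) * k ^ 2\<close> pays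
      for the shift from \<open>n\<close> to \<open>n - l - t\<close>.\<close>
    have "2 * (l + t) \<le> (l + 3) * (k * t)"
    proof -
      have "2 * (l + t) \<le> 2 * (2 * t)" using s by simp
      also have "\<dots> \<le> (l + 3) * (k * t)" using s u by (intro mult_le_mono) auto
      finally show ?thesis .
    qed
    moreover have "(l + 3) * (k * (k - t)) + (l + 3) * (k * t) = (l + 3) * k ^ 2"
      using u by (simp add: power2_eq_square algebra_simps)
    moreover have "a \<le> 2 * (n - l - t)" if "2 * (l + t) \<le> b" "a + b = c" "c \<le> 2 * n" for a b c :: nat
      using that by presburger
    ultimately show "(l + 3) * (k * (k - t)) \<le> 2 * (n - l - t)" using n by blast
  qed
  finally have "2 * ((t + 1) * (k * (k - t))) \<le> 2 * ((t - l) * (n - l - t))"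
    by (simp only: mult_ac)
  then have key: "(t + 1) * (k * (k - t)) \<le> (t - l) * (n - l - t)" by (rule mult_left_le_imp_le) simp
  have kn: "k \<le> n - l"
  proof -
    have "2 * (k + l) \<le> 2 * (2 * k)" using kt s by simp
    also have "\<dots> \<le> (l + 3) * (k * k)" using kt s by (simp only: mult.assoc[symmetric]) (intro mult_le_mono, auto)
    finally show ?thesis using n by (simp add: power2_eq_square)
  qed
  let ?C = "(n - l - t) choose (k - t)" and ?C' = "(n - l - Suc t) choose (k - Suc t)"
  have "(k - t) * (Suc t * t ^ l * (k ^ (t - l) * ?C')) = t ^ l * k ^ (t - l - 1) * ((t + 1) * (k * (k - t))) * ?C'"
  proof -
    have "k ^ (t - l) = k * k ^ (t - l - 1)" using kt by (metis Suc_diff_1 less_le_trans pos2 power_Suc)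
    then show ?thesis by (simp only: Suc_eq_plus1 mult_ac)
  qed
  also have "\<dots> \<le> t ^ l * k ^ (t - l - 1) * ((t - l) * (n - l - t)) * ?C'"
    by (rule mult_le_mono1, rule mult_le_mono2, rule key)
  also have "\<dots> = t ^ l * (t - l) * k ^ (t - l - 1) * ((n - l - t) * ?C')"
    by (simp only: mult_ac)
  also have "\<dots> = t ^ l * (t - l) * k ^ (t - l - 1) * ((k - t) * ?C)"
    using choose_absorb[OF kt(1) kn] by simp
  also have "\<dots> \<le> t * (t - 1) ^ l * k ^ (t - l - 1) * ((k - t) * ?C)"
    by (intro mult_le_mono power_mult_diff_le le_refl)
  also have "\<dots> = (k - t) * (t * (t - 1) ^ l * (k ^ (t - l - 1) * ?C))"
    by (simp only: mult_ac)
  finally have "Suc t * t ^ l * (k ^ (t - l) * ?C') \<le> t * (t - 1) ^ l * (k ^ (t - l - 1) * ?C)"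
    using kt by simp
  also have "\<dots> \<le> (l + 2) * (l + 1) ^ l * (k * ((n - 2 * l - 2) choose (k - l - 2)))"
    using step by simp
  finally show ?case by simp
qed

section \<open>Maximal intersecting families and their transversals\<close>

lemma maximal_intersecting:
  assumes "F \<subseteq> ksubsets n k" "intersecting F" "0 < k"
  obtains G where "F \<subseteq> G" "G \<subseteq> ksubsets n k" "intersecting G"
    "\<And>A. A \<in> ksubsets n k \<Longrightarrow> covers G A \<Longrightarrow> A \<in> G"
proof -
  let ?\<X> = "{G. G \<subseteq> ksubsets n k \<and> intersecting G}"
  have "finite ?\<X>"
    by (rule finite_subset[of _ "Pow (ksubsets n k)"]) (auto simp: finite_ksubsets)
  from finite_has_maximal2[OF this, of F] assms
  obtain G where G: "G \<in> ?\<X>" "F \<subseteq> G" and max: "\<And>H. H \<in> ?\<X> \<Longrightarrow> G \<subseteq> H \<Longrightarrow> G = H"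
    by (metis (no_types, lifting) mem_Collect_eq)
  have "A \<in> G" if A: "A \<in> ksubsets n k" "covers G A" for A
  proof -
    have "A \<noteq> {}" using A(1) assms(3) by (auto simp: ksubsets_def)
    then have "intersecting (insert A G)"
      using G(1) A(2) by (simp add: intersecting_def covers_def Int_commute)
    then have "G = insert A G" using G(1) A(1) by (intro max) auto
    then show ?thesis by blast
  qed
  then show ?thesis using that G by blast
qed

text \<open>If \<open>T\<close> and \<open>U\<close> were disjoint, \<open>n >= 2 * k\<close> would
  leave room to extend \<open>T\<close> to a \<open>k\<close>-set outside \<open>U\<close>. That set
  lies in \<open>G\<close> by maximality, yet \<open>U\<close> misses it.\<close>

lemma transversals_meet:
  assumes "2 * k \<le> n"
    and max: "\<And>A. A \<in> ksubsets n k \<Longrightarrow> covers G A \<Longrightarrow> A \<in> G"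
    and T: "T \<subseteq> {1..n}" "card T \<le> k" "covers G T"
    and U: "U \<subseteq> {1..n}" "card U \<le> k" "covers G U"
  shows "T \<inter> U \<noteq> {}"
proof
  assume disj: "T \<inter> U = {}"
  have "k \<le> card ({1..n} - U)"
    using assms(1) U(1,2) finite_subset[OF U(1)] by (simp add: card_Diff_subset)
  moreover have "T \<subseteq> {1..n} - U" using T(1) disj by blast
  ultimately obtain A where A: "T \<subseteq> A" "A \<subseteq> {1..n} - U" "card A = k"
    using extend_subset[of "{1..n} - U" T k] T(2) by auto
  then have "A \<in> G"
    using covers_mono[OF T(3) A(1)] by (intro max) (auto simp: ksubsets_def)
  then show False using U(3) A(2) unfolding covers_def by blast
qed

lemma card_ksubsets_containing:
  assumes Y: "Y \<subseteq> {1..n}" "card Y = r" and S: "S \<subseteq> {1..n}" "card S = l" and "Y \<inter> S = {}"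
  shows "card {A \<in> ksubsets n k. Y \<subseteq> A \<and> A \<inter> S = {}} \<le> (n - l - r) choose (k - r)"
proof -
  let ?W = "{1..n} - S - Y"
  have fin: "finite Y" "finite S" using Y(1) S(1) finite_subset by auto
  have "card {A \<in> ksubsets n k. Y \<subseteq> A \<and> A \<inter> S = {}} \<le> card {B. B \<subseteq> ?W \<and> card B = k - r}"
  proof (rule card_inj_on_le[of "\<lambda>A. A - Y"])
    show "inj_on (\<lambda>A. A - Y) {A \<in> ksubsets n k. Y \<subseteq> A \<and> A \<inter> S = {}}"
      by (auto simp: inj_on_def)
    show "(\<lambda>A. A - Y) ` {A \<in> ksubsets n k. Y \<subseteq> A \<and> A \<inter> S = {}} \<subseteq> {B. B \<subseteq> ?W \<and> card B = k - r}"
      using Y(2) fin by (auto simp: ksubsets_def card_Diff_subset)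
  qed (rule finite_subset[of _ "Pow ?W"], auto)
  also have "\<dots> = card ?W choose (k - r)" by (rule n_subsets) simp
  also have "card ?W = n - l - r"
  proof -
    have "Y \<subseteq> {1..n} - S" using Y(1) assms(5) by blast
    then show ?thesis using Y(2) S fin by (simp add: card_Diff_subset)
  qed
  finally show ?thesis .
qed

text \<open>With sizes up to \<open>t\<close>, lowering \<open>t\<close> by one just discards the
  sets of size \<open>t\<close>; restriction to the ground set keeps the family finite.\<close>

definition transversals :: "nat \<Rightarrow> nat \<Rightarrow> nat set set \<Rightarrow> nat set set" where
  "transversals n t F = {T. T \<subseteq> {1..n} \<and> card T \<le> t \<and> covers F T}"

text \<open>The first \<open>l + 1\<close> branchings run over transversals and cost
  \<open>t * (t - 1) ^ l\<close>. Up to size \<open>r\<close> a partial set inside a counted member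
  is no transversal, so some member of \<open>F\<close> misses it and offers at most
  \<open>k\<close> choices. The bound is needed both for \<open>r = t\<close> and for
  \<open>r = t + 1 = l + 2\<close>.\<close>

lemma card_without_transversal_le:
  assumes F: "F \<subseteq> ksubsets n k" "intersecting F"
    and S: "S \<subseteq> {1..n}" "card S = l"
    and r: "l + 1 \<le> r" "r \<le> k"
    and nocover: "\<And>X. X \<subseteq> {1..n} \<Longrightarrow> card X \<le> l \<Longrightarrow> \<not> covers (transversals n t F) X"
    and min: "\<And>X. X \<subseteq> {1..n} \<Longrightarrow> card X \<le> l \<Longrightarrow>
        covers {T\<in>transversals n t F. card T < t} X \<Longrightarrow>
        card (avoid (transversals n t F) S) \<le> card (avoid (transversals n t F) X)"
    and \<G>: "\<G> \<subseteq> avoid F S"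
      "\<And>A X. A \<in> \<G> \<Longrightarrow> X \<subseteq> A \<Longrightarrow> card X < r \<Longrightarrow> \<not> covers F X"
  shows "card \<G> \<le> t * (t - 1) ^ l * (k ^ (r - l - 1) * ((n - l - r) choose (k - r)))"
proof -
  have finF: "finite F" using F(1) finite_ksubsets finite_subset by blast
  have fin\<G>: "finite \<G>" using \<G>(1) finite_avoid[OF finF] finite_subset by blast
  have FD: "finite A" "card A = k" "A \<subseteq> {1..n}" if "A \<in> F" for A
    using F(1) that by (auto simp: ksubsets_def intro: finite_subset)
  have \<G>D: "A \<in> F" "A \<inter> S = {}" if "A \<in> \<G>" for A
    using \<G>(1) that by (auto simp: avoid_def)
  define P where "P = (\<lambda>X. X \<subseteq> {1..n} \<and> X \<inter> S = {})"
  have leaf: "card {A\<in>\<G>. X \<subseteq> A} \<le> k ^ (r - l - 1) * ((n - l - r) choose (k - r))"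
    if "P X" "card X = Suc l" for X
  proof (rule branch_iterate[where P = P and r = r])
    show "P X" "finite \<G>" by fact+
    show "card X + (r - l - 1) = r" using that(2) r by simp
    show "finite X" if "P X" for X using that finite_subset unfolding P_def by auto
    show "card {A\<in>\<G>. X \<subseteq> A} \<le> (n - l - r) choose (k - r)" if "P X" "card X = r" for X
    proof -
      have "{A\<in>\<G>. X \<subseteq> A} \<subseteq> {A \<in> ksubsets n k. X \<subseteq> A \<and> A \<inter> S = {}}"
        using \<G>D F(1) by blast
      then have "card {A\<in>\<G>. X \<subseteq> A} \<le> card {A \<in> ksubsets n k. X \<subseteq> A \<and> A \<inter> S = {}}"
        by (intro card_mono) (simp_all add: finite_ksubsets)
      also have "\<dots> \<le> (n - l - r) choose (k - r)"
        using that unfolding P_def by (intro card_ksubsets_containing S) auto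
      finally show ?thesis .
    qed
    fix X assume X: "P X" "card X < r"
    show "\<exists>D. finite D \<and> card D \<le> k \<and> (\<forall>A\<in>\<G>. X \<subseteq> A \<longrightarrow> A \<inter> D \<noteq> {}) \<and>
        (\<forall>x\<in>D. x \<notin> X \<and> P (insert x X))"
    \<comment> \<open>Only an \<open>X\<close> inside some counted member is known to be no
      transversal; otherwise the empty branch set serves vacuously.\<close>
    proof (cases "\<exists>A\<in>\<G>. X \<subseteq> A")
      case True
      then obtain B where B: "B \<in> F" "X \<inter> B = {}"
        using \<G>(2) X(2) unfolding covers_def by blast
      have "A \<inter> (B - S) \<noteq> {}" if "A \<in> \<G>" for A
        using \<G>D[OF that] B(1) F(2) unfolding intersecting_def by blast
      moreover have "card (B - S) \<le> k" using card_mono[of B "B - S"] FD[OF B(1)] by simp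
      moreover have "x \<notin> X \<and> P (insert x X)" if "x \<in> B - S" for x
        using that X(1) B(2) FD(3)[OF B(1)] unfolding P_def by auto
      ultimately show ?thesis using FD(1)[OF B(1)] by (intro exI[of _ "B - S"]) simp
    next
      case False
      then show ?thesis by (intro exI[of _ "{}"]) simp
    qed
  qed
  show ?thesis
  proof (rule card_branching_le)
    show "finite {1..n}" by simp
    show "transversals n t F \<subseteq> Pow {1..n}" by (auto simp: transversals_def)
    show "card T \<le> t" if "T \<in> transversals n t F" for T using that by (simp add: transversals_def)
    show "covers (transversals n t F) A" if "A \<in> \<G>" for A
      using \<G>D(1)[OF that] by (auto simp: covers_def transversals_def)
    show "card {A\<in>\<G>. X \<subseteq> A} \<le> k ^ (r - l - 1) * ((n - l - r) choose (k - r))"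
      if "X \<subseteq> {1..n}" "X \<inter> S = {}" "card X = Suc l" for X
      using leaf that unfolding P_def by simp
  qed (fact nocover S min fin\<G> \<G>D(2))+
qed

section \<open>Consequences of the lower bound on \<open>n\<close>\<close>

lemma binom_of_nat: "binom (int a) (int b) = a choose b"
  by (simp add: binom_def binomial_eq_0)

text \<open>By absorption the quotient of the two binomials is
  \<open>(n - 2 * l - 1) / (k - l - 1)\<close>, which is at least \<open>n / k\<close> because
  \<open>n >= 2 * k\<close>. It remains to multiply the assumption on \<open>M\<close> by the second
  binomial and cancel \<open>k\<close>.\<close>

lemma second_term_le_first:
  assumes k: "l + 2 \<le> k" and n: "2 * k \<le> n"
    and M: "a * k ^ 2 \<le> M * n + b * k ^ 2"
  shows "a * (k * ((n - 2 * l - 2) choose (k - l - 2)))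
           \<le> M * ((n - 2 * l - 1) choose (k - l - 1)) + b * k * ((n - 2 * l - 2) choose (k - l - 2))"
proof -
  let ?C = "(n - 2 * l - 1) choose (k - l - 1)" and ?C' = "(n - 2 * l - 2) choose (k - l - 2)"
  have absorb: "(k - l - 1) * ?C = (n - 2 * l - 1) * ?C'"
    using times_binomial_minus1_eq[of "k - l - 1" "n - 2 * l - 1"] k by (simp add: numeral_2_eq_2)
  have "(k - l - 1) * n \<le> k * (n - 2 * l - 1)"
  proof -
    have "(2 * l + 1) * k \<le> (l + 1) * (2 * k)" by (simp add: algebra_simps)
    also have "\<dots> \<le> (l + 1) * n" using n by (rule mult_le_mono2)
    finally have "k * (2 * l + 1) \<le> (l + 1) * n" by (simp add: mult.commute)
    moreover have "(k - l - 1) * n = k * n - (l + 1) * n" "k * (n - 2 * l - 1) = k * n - k * (2 * l + 1)"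
      by (simp_all add: diff_mult_distrib diff_mult_distrib2 algebra_simps)
    ultimately show ?thesis by simp
  qed
  then have "(k - l - 1) * n * ?C' \<le> k * (n - 2 * l - 1) * ?C'" by (rule mult_le_mono1)
  also have "\<dots> = (k - l - 1) * (k * ?C)" using absorb by simp
  finally have "n * ?C' \<le> k * ?C" using k by simp
  then have *: "M * (n * ?C') \<le> M * (k * ?C)" by (rule mult_le_mono2)
  have "k * (a * (k * ?C')) = a * k ^ 2 * ?C'" by (simp add: power2_eq_square)
  also have "\<dots> \<le> (M * n + b * k ^ 2) * ?C'" using M by (rule mult_le_mono1)
  also have "\<dots> = M * (n * ?C') + b * k ^ 2 * ?C'" by (simp add: algebra_simps)
  also have "\<dots> \<le> M * (k * ?C) + b * k ^ 2 * ?C'" using * by simp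
  also have "\<dots> = k * (M * ?C + b * k * ?C')" by (simp add: power2_eq_square algebra_simps)
  finally show ?thesis using k by simp
qed

text \<open>The first claim clears the denominator. For the second, \<open>m_div_le\<close> and
  \<open>2 * l ^ l <= (l + 1) ^ l\<close> leave the coefficient
  \<open>(l + 2) - (l + 1) / 2 = (l + 3) / 2\<close> once \<open>(l + 1) ^ l\<close> is
  cancelled.\<close>

lemma m_div_coefficient_bounds:
  fixes n k l :: nat
  assumes "0 < l"
    and n: "real n \<ge> ((real l + 2) * (real l + 1) ^ l - (real l + 1) * real l ^ l)
                    / real (m_div l (l + 1)) * real k ^ 2"
  shows "(l + 2) * (l + 1) ^ l * k ^ 2 \<le> m_div l (l + 1) * n + (l + 1) * l ^ l * k ^ 2"
    and "(l + 3) * k ^ 2 \<le> 2 * n"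
proof -
  let ?M = "m_div l (l + 1)"
  have "real ?M > 0" using m_div_pos[of l] by linarith
  then have "((real l + 2) * (real l + 1) ^ l - (real l + 1) * real l ^ l) * real k ^ 2 \<le> real ?M * real n"
    using n by (simp add: field_simps)
  then have "real ((l + 2) * (l + 1) ^ l * k ^ 2) \<le> real (?M * n + (l + 1) * l ^ l * k ^ 2)"
    by (simp add: algebra_simps)
  then show 1: "(l + 2) * (l + 1) ^ l * k ^ 2 \<le> ?M * n + (l + 1) * l ^ l * k ^ 2"
    by (rule of_nat_le_iff[THEN iffD1])
  have "(l + 1) * k ^ 2 * (2 * l ^ l) \<le> (l + 1) * k ^ 2 * (l + 1) ^ l"
    using two_power_le[OF assms(1)] by (rule mult_le_mono2)
  moreover have "?M * n \<le> (l + 1) ^ l * n" using m_div_le by (rule mult_le_mono1)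
  moreover have "p * ((l + 3) * v) \<le> p * (2 * n)"
    if "(l + 1) * v * (2 * q) \<le> (l + 1) * v * p" "u \<le> p * n" "(l + 2) * p * v \<le> u + (l + 1) * q * v"
    for p q u v :: nat
  proof -
    have "p * ((l + 3) * v) + (l + 1) * v * p = 2 * ((l + 2) * p * v)" by (simp add: algebra_simps)
    moreover have "(l + 1) * v * (2 * q) = 2 * ((l + 1) * q * v)" by (simp add: algebra_simps)
    moreover have "p * (2 * n) = 2 * (p * n)" by simp
    ultimately show ?thesis using that by linarith
  qed
  ultimately have "(l + 1) ^ l * ((l + 3) * k ^ 2) \<le> (l + 1) ^ l * (2 * n)" using 1 by blast
  then show "(l + 3) * k ^ 2 \<le> 2 * n" by simp
qed

section \<open>Assembly of the diversity bound\<close>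

theorem theorem1p1:
  fixes n k l :: nat and F :: "nat set set"
  assumes "k > l" and "l \<ge> 2"
    and "real n \<ge> ((real l + 2) * (real l + 1) ^ l - (real l + 1) * real l ^ l)
                    / real (m_div l (l + 1)) * real k ^ 2"
    and "F \<subseteq> ksubsets n k" and "intersecting F"
  shows "diversity n l F \<le>
           m_div l (l + 1) * binom (int n - 2 * int l - 1) (int k - int l - 1)
           + (l + 1) * l ^ l * k * binom (int n - 2 * int l - 2) (int k - int l - 2)"
proof -
  define M where "M = m_div l (l + 1)"
  have n1: "(l + 2) * (l + 1) ^ l * k ^ 2 \<le> M * n + (l + 1) * l ^ l * k ^ 2"
    and n2: "(l + 3) * k ^ 2 \<le> 2 * n"
    using m_div_coefficient_bounds[OF _ assms(3)] assms(2) unfolding M_def by simp_all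
  have nk: "2 * k \<le> n"
  proof -
    have "4 * k \<le> (l + 3) * k ^ 2"
      using assms(1,2) unfolding power2_eq_square by (intro mult_le_mono) auto
    then show ?thesis using n2 by linarith
  qed
  have ln: "l \<le> n" using nk assms(1) by simp
  let ?V = "{1..n}"
  let ?C1 = "(n - 2 * l - 1) choose (k - l - 1)" and ?C2 = "(n - 2 * l - 2) choose (k - l - 2)"
  obtain G where FG: "F \<subseteq> G" and G: "G \<subseteq> ksubsets n k" "intersecting G"
    and max: "\<And>A. A \<in> ksubsets n k \<Longrightarrow> covers G A \<Longrightarrow> A \<in> G"
    using maximal_intersecting[OF assms(4,5)] assms(1) by auto
  have finG: "finite G" using G(1) finite_ksubsets finite_subset by blast
  have GD: "A \<subseteq> ?V" "card A = k" "covers G A" if "A \<in> G" for A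
    using G that by (auto simp: ksubsets_def intersecting_def covers_def)
  define C where "C = (\<lambda>t. transversals n t G)"
  have finC: "finite (C t)" for t
    unfolding C_def transversals_def by (rule finite_subset[of _ "Pow ?V"]) auto
  \<comment> \<open>For \<open>k = l + 1\<close> truncated subtraction makes \<open>?C2\<close>
    equal to 1, whereas the integer binomial vanishes; hence the conditional.\<close>
  have bound: "diversity n l G \<le> M * ?C1 + (if l + 2 \<le> k then (l + 1) * l ^ l * k * ?C2 else 0)"
  proof (cases "\<exists>T\<subseteq>?V. card T \<le> l \<and> covers G T")
    case True
    then obtain T where T: "T \<subseteq> ?V" "card T \<le> l" "covers G T" by blast
    obtain S where S: "T \<subseteq> S" "S \<subseteq> ?V" "card S = l"
      using extend_subset[of ?V T l] T(1,2) ln by auto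
    have "avoid G S = {}" using T(3) S(1) unfolding avoid_def covers_def by blast
    then show ?thesis using diversity_le[OF S(2,3), of G] by simp
  next
    case False
    then have large: "l < card T" if "T \<subseteq> ?V" "covers G T" for T
      using that not_le by blast
    define Q where "Q = (\<lambda>t. \<forall>X\<subseteq>?V. card X \<le> l \<longrightarrow> \<not> covers (C t) X)"
    \<comment> \<open>Members of \<open>G\<close> are themselves transversals of size
      \<open>k\<close>, so at most \<open>l\<close> points meeting all of \<open>C k\<close> would
      form a transversal that is too small.\<close>
    have "Q k"
      unfolding Q_def
    proof (intro allI impI notI)
      fix X assume X: "X \<subseteq> ?V" "card X \<le> l" "covers (C k) X"
      have "G \<subseteq> C k" using GD by (auto simp: C_def transversals_def)
      then have "covers G X" using X(3) unfolding covers_def by blast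
      then show False using large[of X] X(1,2) by simp
    qed
    define t where "t = (LEAST t. Q t)"
    have Qt: "Q t" and tk: "t \<le> k" and least: "\<And>s. s < t \<Longrightarrow> \<not> Q s"
      unfolding t_def using \<open>Q k\<close> by (auto intro: LeastI Least_le dest: not_less_Least)
    have lt: "l < t"
    proof (rule ccontr)
      assume "\<not> l < t"
      then have "T \<notin> C t" for T using large[of T] by (auto simp: C_def transversals_def)
      then have "covers (C t) {}" by (simp add: covers_def)
      then show False using Qt unfolding Q_def by auto
    qed
    have Ct1: "C (t - 1) = {T\<in>C t. card T < t}"
      using lt by (auto simp: C_def transversals_def)
    obtain X0 where X0: "X0 \<subseteq> ?V" "card X0 \<le> l" "covers {T\<in>C t. card T < t} X0"
    proof -
      have "\<not> Q (t - 1)" using lt by (intro least) simp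
      then show ?thesis using that unfolding Q_def Ct1 by blast
    qed
    \<comment> \<open>Candidates have exactly \<open>l\<close> points, as \<open>diversity\<close>
      demands. Enlarging a set only lowers what it misses, so \<open>min\<close> carries minimality
      over to smaller sets.\<close>
    define cand where "cand = (\<lambda>S. S \<subseteq> ?V \<and> card S = l \<and> covers {T\<in>C t. card T < t} S)"
    have ext: "\<exists>Y. X \<subseteq> Y \<and> cand Y"
      if X: "X \<subseteq> ?V" "card X \<le> l" "covers {T\<in>C t. card T < t} X" for X
    proof -
      obtain Y where "X \<subseteq> Y" "Y \<subseteq> ?V" "card Y = l"
        using extend_subset[of ?V X l] X(1,2) ln by auto
      then show ?thesis using covers_mono[OF X(3)] unfolding cand_def by blast
    qed
    obtain S where S: "cand S" and Smin: "\<And>Y. cand Y \<Longrightarrow> card (avoid (C t) S) \<le> card (avoid (C t) Y)"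
    proof -
      obtain Y where "cand Y" using ext[OF X0] by blast
      from ex_has_least_nat[of cand, OF this, of "\<lambda>S. card (avoid (C t) S)"] show ?thesis
        using that by blast
    qed
    have SV: "S \<subseteq> ?V" "card S = l" and Scov: "covers {T\<in>C t. card T < t} S"
      using S unfolding cand_def by auto
    have min: "card (avoid (C t) S) \<le> card (avoid (C t) X)"
      if X: "X \<subseteq> ?V" "card X \<le> l" "covers {T\<in>C t. card T < t} X" for X
    proof -
      obtain Y where Y: "X \<subseteq> Y" "cand Y" using ext[OF X] by blast
      have "card (avoid (C t) Y) \<le> card (avoid (C t) X)"
        using Y(1) by (intro card_mono finite_avoid finC) (auto simp: avoid_def)
      then show ?thesis using Smin[OF Y(2)] by linarith
    qed
    have count: "card \<G> \<le> t * (t - 1) ^ l * (k ^ (r - l - 1) * ((n - l - r) choose (k - r)))"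
      if "l + 1 \<le> r" "r \<le> k" "\<G> \<subseteq> avoid G S"
        "\<And>A X. A \<in> \<G> \<Longrightarrow> X \<subseteq> A \<Longrightarrow> card X < r \<Longrightarrow> \<not> covers G X" for \<G> r
      by (rule card_without_transversal_le[OF G SV that(1,2) _ _ that(3,4)])
        (use Qt min in \<open>auto simp: Q_def C_def\<close>)
    have div: "diversity n l G \<le> card (avoid G S)" by (rule diversity_le[OF SV])
    have avoidD: "A \<in> G" "A \<inter> S = {}" if "A \<in> avoid G S" for A
      using that by (auto simp: avoid_def)
    show ?thesis
    proof (cases "t = l + 1")
      case False
      then have lt2: "l + 2 \<le> t" using lt by simp
      \<comment> \<open>\<open>S\<close> meets every transversal smaller than \<open>t\<close>,
        whereas \<open>A\<close> avoids \<open>S\<close>. So branching over members may go on up to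
        size \<open>r = t\<close>.\<close>
      have "\<not> covers G X" if A: "A \<in> avoid G S" "X \<subseteq> A" "card X < t" for A X
      proof
        assume "covers G X"
        then have "X \<in> {T\<in>C t. card T < t}"
          using GD(1)[OF avoidD(1)[OF A(1)]] A(2,3) by (auto simp: C_def transversals_def)
        then have "S \<inter> X \<noteq> {}" using Scov unfolding covers_def by blast
        then show False using avoidD(2)[OF A(1)] A(2) by blast
      qed
      then have "card (avoid G S)
          \<le> t * (t - 1) ^ l * (k ^ (t - l - 1) * ((n - l - t) choose (k - t)))"
        using lt2 tk by (intro count) auto
      also have "\<dots> \<le> (l + 2) * (l + 1) ^ l * (k * ?C2)"
        by (rule branch_bound_decreasing[OF n2 lt2 tk])
      also have "\<dots> \<le> M * ?C1 + (l + 1) * l ^ l * k * ?C2"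
        using second_term_le_first[OF _ nk n1] lt2 tk by simp
      finally show ?thesis using div lt2 tk by simp
    next
      case True
      have CD: "T \<subseteq> ?V" "card T = l + 1" "covers G T" if "T \<in> C t" for T
        using that large[of T] True by (auto simp: C_def transversals_def)
      have Cint: "intersecting (C t)"
        unfolding intersecting_def
      proof (intro ballI)
        fix A B assume "A \<in> C t" "B \<in> C t"
        then show "A \<inter> B \<noteq> {}"
          using transversals_meet[OF nk max, of A B] CD[of A] CD[of B] assms(1) by simp
      qed
      have Ccov: "covers (C t) T" if "T \<in> C t" for T
        using Cint that unfolding intersecting_def covers_def by blast
      obtain T0 where T0: "T0 \<in> C t" using Qt unfolding Q_def covers_def by auto
      have finT0: "finite T0" using CD(1)[OF T0] finite_subset by blast
      have "l + 1 \<le> card T" if T: "finite T" "covers (C t) T" for T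
      proof -
        \<comment> \<open>\<open>cover_number\<close> ranges over arbitrary finite sets, so a cover
          is first cut down to the ground set.\<close>
        have "covers (C t) (T \<inter> ?V)" using T(2) CD(1) unfolding covers_def by blast
        then have "\<not> card (T \<inter> ?V) \<le> l" using Qt unfolding Q_def by blast
        then show ?thesis using card_mono[OF T(1), of "T \<inter> ?V"] by auto
      qed
      then have "cover_number (C t) = l + 1"
        using cover_number_ge[OF finT0 Ccov[OF T0]] cover_number_le[OF finT0 Ccov[OF T0]] CD(2)[OF T0]
        by (intro antisym) auto
      then have divM: "diversity n l (C t) \<le> M"
        unfolding M_def using CD Cint by (intro diversity_le_m_div) (auto simp: ksubsets_def)
      obtain S' where S': "S' \<subseteq> ?V" "card S' = l" "diversity n l (C t) = card (avoid (C t) S')"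
        using diversity_attained[OF ln] by blast
      \<comment> \<open>With no smaller transversals, every \<open>l\<close>-set competes with
        \<open>S\<close>, in particular one attaining the diversity of \<open>C t\<close>.\<close>
      have "{T\<in>C t. card T < t} = {}" using CD(2) True by fastforce
      then have "covers {T\<in>C t. card T < t} S'" by (auto simp: covers_def)
      then have SM: "card (avoid (C t) S) \<le> M" using min[of S'] S' divM by simp
      define \<A> where "\<A> = (\<lambda>T. {A \<in> ksubsets n k. T \<subseteq> A \<and> A \<inter> S = {}})"
      define \<G> where "\<G> = {A \<in> avoid G S. \<forall>T\<in>avoid (C t) S. \<not> T \<subseteq> A}"
      have finA: "finite (\<A> T)" for T unfolding \<A>_def by (simp add: finite_ksubsets)
      have fin\<G>: "finite \<G>" unfolding \<G>_def using finite_avoid[OF finG] by simp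
      have "card (\<A> T) \<le> ?C1" if "T \<in> avoid (C t) S" for T
      proof -
        have T: "T \<in> C t" "T \<inter> S = {}" using that by (auto simp: avoid_def)
        have "n - l - (l + 1) = n - 2 * l - 1" "k - (l + 1) = k - l - 1" by simp_all
        then show ?thesis
          using card_ksubsets_containing[OF CD(1,2)[OF T(1)] SV T(2), of k] unfolding \<A>_def by simp
      qed
      then have "(\<Sum>T\<in>avoid (C t) S. card (\<A> T)) \<le> card (avoid (C t) S) * ?C1"
        using sum_bounded_above[of "avoid (C t) S" "\<lambda>T. card (\<A> T)" ?C1] by simp
      also have "\<dots> \<le> M * ?C1" using SM by (rule mult_le_mono1)
      finally have main: "(\<Sum>T\<in>avoid (C t) S. card (\<A> T)) \<le> M * ?C1" .
      have "avoid G S \<subseteq> (\<Union>T\<in>avoid (C t) S. \<A> T) \<union> \<G>"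
      proof
        fix A assume A: "A \<in> avoid G S"
        then have "A \<in> ksubsets n k" "A \<inter> S = {}" using G(1) avoidD by blast+
        then show "A \<in> (\<Union>T\<in>avoid (C t) S. \<A> T) \<union> \<G>" using A unfolding \<G>_def \<A>_def by auto
      qed
      then have "card (avoid G S) \<le> card ((\<Union>T\<in>avoid (C t) S. \<A> T) \<union> \<G>)"
        using finA fin\<G> finite_avoid[OF finC] by (intro card_mono) auto
      also have "\<dots> \<le> card (\<Union>T\<in>avoid (C t) S. \<A> T) + card \<G>" by (rule card_Un_le)
      also have "\<dots> \<le> M * ?C1 + card \<G>"
        using card_UN_le[OF finite_avoid[OF finC], of \<A> t S] main by linarith
      finally have split: "card (avoid G S) \<le> M * ?C1 + card \<G>" .
      have nontrans: "\<not> covers G X" if A: "A \<in> \<G>" "X \<subseteq> A" "card X < l + 2" for A X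
      proof
        assume "covers G X"
        have AS: "A \<in> avoid G S" using A(1) unfolding \<G>_def by blast
        have "X \<in> C t" using \<open>covers G X\<close> GD(1)[OF avoidD(1)[OF AS]] A(2,3) True
          by (auto simp: C_def transversals_def)
        then have "X \<in> avoid (C t) S" using avoidD(2)[OF AS] A(2) by (auto simp: avoid_def)
        then show False using A(1,2) unfolding \<G>_def by blast
      qed
      have sub: "\<G> \<subseteq> avoid G S" unfolding \<G>_def by blast
      show ?thesis
      proof (cases "l + 2 \<le> k")
        case k: True
        have "n - l - (l + 2) = n - 2 * l - 2" "k - (l + 2) = k - l - 2" by simp_all
        \<comment> \<open>Here \<open>t = l + 1\<close> and \<open>r = l + 2\<close>:
          \<open>t * (t - 1) ^ l\<close> becomes \<open>(l + 1) * l ^ l\<close>, and one further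
          branching gives \<open>k\<close>.\<close>
        then have "card \<G> \<le> (l + 1) * l ^ l * (k * ?C2)"
          using count[OF _ k sub nontrans] True by simp
        then show ?thesis using split div k by (simp add: mult.assoc)
      next
        case False
        \<comment> \<open>Now \<open>k = l + 1\<close>, so a member of \<open>\<G>\<close> would
          itself be a transversal of size \<open>l + 1\<close>, which \<open>nontrans\<close>
          excludes.\<close>
        have "\<G> = {}"
          proof (rule equals0I)
          fix A assume A: "A \<in> \<G>"
          then have "A \<in> G" using sub avoidD(1) by blast
          then show False using nontrans[OF A subset_refl] GD(2,3) False by simp
        qed
        then show ?thesis using split div False by simp
      qed
    qed
  qed
  have "diversity n l F \<le> diversity n l G" by (rule diversity_mono[OF ln FG finG])
  moreover have "binom (int n - 2 * int l - 1) (int k - int l - 1) = ?C1"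
  proof -
    have "int n - 2 * int l - 1 = int (n - 2 * l - 1)" "int k - int l - 1 = int (k - l - 1)"
      using nk assms(1) by simp_all
    then show ?thesis by (simp only: binom_of_nat)
  qed
  moreover have "binom (int n - 2 * int l - 2) (int k - int l - 2) = ?C2" if "l + 2 \<le> k"
  proof -
    have "int n - 2 * int l - 2 = int (n - 2 * l - 2)" "int k - int l - 2 = int (k - l - 2)"
      using nk that by simp_all
    then show ?thesis by (simp only: binom_of_nat)
  qed
  ultimately show ?thesis using bound unfolding M_def by (auto split: if_splits)
qed

end
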